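(* Let $G$ be a graph of order $n\ge 2$ with minimum degree $\delta(G)\ge 1$, and let $k$ be an integer with $\gamma(G)\le k\le n$. If $G\cong D_k(G)$, then $k=2$, $n\ge 4$, and $G\cong K_{1,n-1}$.
   Context: Graphs are finite and simple, with nonempty vertex set. A set $S\subseteq V(G)$ is a dominating set of $G$ if every vertex in $V(G)\setminus S$ is adjacent to at least one vertex of $S$. The domination number $\gamma(G)$ is the minimum cardinality of a dominating set of $G$. For a positive integer $k$, the $k$-dominating graph $D_k(G)$ is the graph whose vertices are the dominating sets of $G$ of cardinality at most $k$, two of them being adjacent if and only if one is obtained from the other by adding or deleting a single vertex. $\cong$ denotes graph isomorphism, and $K_{1,n-1}$ is the star with $n-1$ leaves. *)

theory Defs
  imports "Graph_Theory.Graph_Theory"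
begin

text \<open>
  A finite simple graph is a \<^locale>\<open>pair_graph\<close>: finite vertex set, loop-free symmetric
  set of arcs given as ordered pairs, so that each undirected edge is a pair of opposite arcs.
\<close>

text \<open>By symmetry, the degree of a vertex is its out-degree.\<close>

definition min_degree :: "'a pair_pre_digraph \<Rightarrow> nat" where
  "min_degree G = Min (out_degree (with_proj G) ` pverts G)"

definition dominating_set :: "'a pair_pre_digraph \<Rightarrow> 'a set \<Rightarrow> bool" where
  "dominating_set G S \<longleftrightarrow> S \<subseteq> pverts G \<and> (\<forall>v \<in> pverts G - S. \<exists>u \<in> S. (v, u) \<in> parcs G)"

definition domination_number :: "'a pair_pre_digraph \<Rightarrow> nat" where
  "domination_number G = Min (card ` {S. dominating_set G S})"

definition k_dominating_graph :: "nat \<Rightarrow> 'a pair_pre_digraph \<Rightarrow> 'a set pair_pre_digraph" where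
  "k_dominating_graph k G =
    (let D = {S. dominating_set G S \<and> card S \<le> k} in
     \<lparr> pverts = D,
       parcs = {(S, T). S \<in> D \<and> T \<in> D \<and>
                  ((\<exists>x. x \<notin> S \<and> T = insert x S) \<or> (\<exists>x \<in> S. T = S - {x}))} \<rparr>)"

text \<open>The star with \<open>m\<close> leaves: centre \<open>0\<close>, leaves \<open>1, \<dots>, m\<close>.\<close>

definition star_graph :: "nat \<Rightarrow> nat pair_pre_digraph" where
  "star_graph m = \<lparr> pverts = {0..m}, parcs = {0} \<times> {1..m} \<union> {1..m} \<times> {0} \<rparr>"

lemma finite_dominating_sets:
  assumes "finite (pverts G)"
  shows "finite {S. dominating_set G S}"
  by (rule finite_subset[of _ "Pow (pverts G)"]) (auto simp: dominating_set_def assms)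

lemma dominating_set_pverts: "dominating_set G (pverts G)"
  by (simp add: dominating_set_def)

lemma pair_graph_k_dominating_graph:
  assumes "pair_graph G"
  shows "pair_graph (k_dominating_graph k G)"
proof -
  interpret pair_graph G by fact
  let ?D = "{S. dominating_set G S \<and> card S \<le> k}"
  have fin: "finite ?D"
    using finite_dominating_sets[OF pair_finite_verts] by (rule rev_finite_subset) auto
  have "parcs (k_dominating_graph k G) \<subseteq> ?D \<times> ?D"
    by (auto simp: k_dominating_graph_def Let_def)
  then have fin': "finite (parcs (k_dominating_graph k G))"
    using fin by (meson finite_SigmaI finite_subset)
  show ?thesis
    by unfold_locales
       (use fin fin' in \<open>auto simp: k_dominating_graph_def Let_def symmetric_def intro!: symI\<close>)
qed

lemma star_graph_complete_bipartite: "complete_bipartite_digraph 1 m (with_proj (star_graph m))"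
  unfolding complete_bipartite_digraph_pair_def
  by (intro conjI exI[of _ "{0}"] exI[of _ "{1..m}"]) (auto simp: star_graph_def)

text \<open>On pairs of simple graphs, isomorphism of digraphs is the usual adjacency-preserving bijection.\<close>

lemma digraph_iso_with_proj_iff:
  assumes "pair_wf_digraph G" "pair_wf_digraph H"
  shows "digraph_iso (with_proj G) (with_proj H) \<longleftrightarrow>
    (\<exists>f. bij_betw f (pverts G) (pverts H) \<and>
      (\<forall>u \<in> pverts G. \<forall>v \<in> pverts G. (u, v) \<in> parcs G \<longleftrightarrow> (f u, f v) \<in> parcs H))"
    (is "?L \<longleftrightarrow> ?R")
proof
  interpret G: pair_wf_digraph G by fact
  assume ?L
  then obtain h where h: "pre_digraph.digraph_isomorphism (with_proj G) h"
    and H: "with_proj H = app_iso h (with_proj G)"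
    by (auto simp: digraph_iso_def)
  let ?f = "iso_verts h"
  have inj: "inj_on ?f (pverts G)"
    using h by (simp add: pre_digraph.digraph_isomorphism_def)
  have V: "pverts H = ?f ` pverts G"
    using arg_cong[OF H, of verts] by simp
  have A: "parcs H = iso_arcs h ` parcs G"
    using arg_cong[OF H, of arcs] by simp
  have t: "iso_tail h = fst" "iso_head h = snd"
    using arg_cong[OF H, of tail] arg_cong[OF H, of head] by simp_all
  have arc: "iso_arcs h a = (?f (fst a), ?f (snd a))" if "a \<in> parcs G" for a
    using h that by (simp add: pre_digraph.digraph_isomorphism_def t prod_eq_iff)
  have "(u, v) \<in> parcs G \<longleftrightarrow> (?f u, ?f v) \<in> parcs H" if uv: "u \<in> pverts G" "v \<in> pverts G" for u v
  proof
    assume "(u, v) \<in> parcs G"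
    then show "(?f u, ?f v) \<in> parcs H"
      using arc[of "(u, v)"] by (auto simp: A intro: rev_image_eqI)
  next
    assume "(?f u, ?f v) \<in> parcs H"
    then obtain a where a: "a \<in> parcs G" "(?f u, ?f v) = iso_arcs h a"
      by (auto simp: A)
    then have "?f u = ?f (fst a)" "?f v = ?f (snd a)"
      using arc by auto
    then have "u = fst a" "v = snd a"
      using inj uv a(1) G.arc_fst_in_verts G.arc_snd_in_verts by (metis inj_onD)+
    then show "(u, v) \<in> parcs G" using a by simp
  qed
  then show ?R
    using inj V by (auto simp: bij_betw_def intro!: exI[of _ ?f])
next
  interpret G: pair_wf_digraph G by fact
  interpret H: pair_wf_digraph H by fact
  assume ?R
  then obtain f where inj: "inj_on f (pverts G)" and V: "pverts H = f ` pverts G"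
    and adj: "\<And>u v. u \<in> pverts G \<Longrightarrow> v \<in> pverts G \<Longrightarrow>
      (u, v) \<in> parcs G \<longleftrightarrow> (f u, f v) \<in> parcs H"
    by (auto simp: bij_betw_def)
  let ?h = "\<lparr> iso_verts = f, iso_arcs = map_prod f f, iso_head = snd, iso_tail = fst \<rparr>"
  have "inj_on (map_prod f f) (parcs G)"
    by (rule inj_on_subset[OF map_prod_inj_on[OF inj inj]]) (auto dest: G.wellformed')
  then have iso: "pre_digraph.digraph_isomorphism (with_proj G) ?h"
    using inj by (simp add: pre_digraph.digraph_isomorphism_def G.wf_digraph)
  have "parcs H = map_prod f f ` parcs G"
  proof
    show "parcs H \<subseteq> map_prod f f ` parcs G"
    proof
      fix e assume e: "e \<in> parcs H"
      then obtain u v where uv: "u \<in> pverts G" "v \<in> pverts G" "e = (f u, f v)"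
        using H.arc_fst_in_verts[OF e] H.arc_snd_in_verts[OF e] V by (cases e) auto
      then show "e \<in> map_prod f f ` parcs G"
        using e adj by (auto intro: rev_image_eqI)
    qed
    show "map_prod f f ` parcs G \<subseteq> parcs H"
      using adj by (auto dest: G.wellformed')
  qed
  then have "with_proj H = app_iso ?h (with_proj G)"
    by (simp add: app_iso_def with_proj_def V)
  with iso show ?L by (auto simp: digraph_iso_def)
qed

end

theory Submission
  imports Defs
begin

text \<open>
  Adjacent vertices of \<open>D\<^sub>k(G)\<close> are sets of opposite parity, so \<open>G\<close> is bipartite; as it has no
  isolated vertex, both sides dominate and \<open>n \<ge> 2\<gamma>\<close>. If \<open>k = \<gamma>\<close> then \<open>D\<^sub>k(G)\<close> has no
  edge, and if \<open>k \<ge> \<gamma> + 2\<close> then a minimum dominating set already has too many supersets in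
  \<open>D\<^sub>k(G)\<close>. If \<open>k = \<gamma> + 1\<close>, the vertices of \<open>G\<close> corresponding to the sets of size \<open>\<gamma>\<close> form a
  dominating set, so there are at least \<open>\<gamma>\<close> of them, while a minimum dominating set has
  \<open>n - \<gamma>\<close> supersets of size \<open>\<gamma> + 1\<close>. Both bounds are therefore equalities and \<open>G\<close> is
  \<open>K\<^bsub>\<gamma>,n-\<gamma>\<^esub>\<close>. Any two vertices from opposite sides dominate it, which forces \<open>\<gamma> = 1\<close>.
\<close>

lemma domination_number_le:
  assumes "finite (pverts G)" "dominating_set G S"
  shows "domination_number G \<le> card S"
  unfolding domination_number_def
  using assms finite_dominating_sets[OF assms(1)] by (intro Min_le) auto

lemma minimum_dominating_set:
  assumes "finite (pverts G)"
  obtains S where "dominating_set G S" "card S = domination_number G"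
proof -
  have "domination_number G \<in> card ` {S. dominating_set G S}"
    unfolding domination_number_def
    using finite_dominating_sets[OF assms] dominating_set_pverts[of G] by (intro Min_in) auto
  then show ?thesis using that by auto
qed

lemma dominating_set_superset:
  assumes "dominating_set G S" "S \<subseteq> T" "T \<subseteq> pverts G"
  shows "dominating_set G T"
  using assms unfolding dominating_set_def by blast

lemma neighbour_of_min_degree:
  assumes "finite (pverts G)" "min_degree G \<ge> 1" "v \<in> pverts G"
  obtains w where "(v, w) \<in> parcs G"
proof -
  have "min_degree G \<le> out_degree (with_proj G) v"
    unfolding min_degree_def using assms by (intro Min_le) auto
  with assms(2) have "out_degree (with_proj G) v \<noteq> 0" by simp
  then have "out_arcs (with_proj G) v \<noteq> {}" by (auto simp: out_degree_def)
  then show ?thesis using that by (auto simp: out_arcs_def)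
qed

text \<open>No vertex is isolated, so every vertex of \<open>G\<close> lying in \<open>I\<close> has
  a neighbour, and independence puts that neighbour outside \<open>I\<close>.\<close>

lemma dominating_set_Diff_independent:
  assumes "pair_wf_digraph G" "finite (pverts G)" "min_degree G \<ge> 1"
    and "\<And>u v. u \<in> I \<Longrightarrow> v \<in> I \<Longrightarrow> (u, v) \<notin> parcs G"
  shows "dominating_set G (pverts G - I)"
  unfolding dominating_set_def
proof (intro conjI ballI)
  fix v assume v: "v \<in> pverts G - (pverts G - I)"
  then obtain w where w: "(v, w) \<in> parcs G"
    using neighbour_of_min_degree[OF assms(2,3)] by blast
  then have "w \<in> pverts G"
    using pair_wf_digraph.arc_snd_in_verts[OF assms(1)] by fastforce
  then show "\<exists>u \<in> pverts G - I. (v, u) \<in> parcs G"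
    using assms(4)[of v w] v w by blast
qed blast

text \<open>Meant for a minimum dominating set \<open>D\<close>: its supersets dominate as well, so
  these are lower bounds for the order of the \<open>k\<close>-dominating graph once
  \<open>k\<close> is at least \<open>card D + 2\<close>.\<close>

lemma card_supersets_at_least:
  assumes "finite V" "D \<subseteq> V" "D \<noteq> V"
  shows "card {S. D \<subseteq> S \<and> S \<subseteq> V \<and> card S \<le> card D + 2} \<ge> 2 * card (V - D)"
    and "card (V - D) \<ge> 3 \<Longrightarrow>
      card {S. D \<subseteq> S \<and> S \<subseteq> V \<and> card S \<le> card D + 2} > 2 * card (V - D)"
proof -
  let ?M = "V - D"
  let ?P = "{S. D \<subseteq> S \<and> S \<subseteq> V \<and> card S \<le> card D + 2}"
  have fD: "finite D" and fM: "finite ?M" using assms finite_subset by auto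
  have finP: "finite ?P" using assms(1) by (rule_tac finite_subset[of _ "Pow V"]) auto
  obtain y where y: "y \<in> ?M" using assms(2,3) by blast
  \<comment> \<open>With \<open>y\<close> fixed and m the size of \<open>V - D\<close>, this lists 1
    + m + (m - 1) sets: \<open>D\<close>, its extensions by one element, and its extensions by two
    elements of which one is \<open>y\<close>.\<close>
  define L where "L = insert D ((\<lambda>x. insert x D) ` ?M \<union> (\<lambda>x. insert x (insert y D)) ` (?M - {y}))"
  have LP: "L \<subseteq> ?P"
    using assms(2) y fD by (auto simp: L_def card_insert_if)
  have "card ((\<lambda>x. insert x D) ` ?M) = card ?M"
    by (rule card_image) (auto simp: inj_on_def)
  moreover have "card ((\<lambda>x. insert x (insert y D)) ` (?M - {y})) = card ?M - 1"
    using y fM by (subst card_image) (auto simp: inj_on_def)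
  moreover have "(\<lambda>x. insert x D) ` ?M \<inter> (\<lambda>x. insert x (insert y D)) ` (?M - {y}) = {}"
  proof -
    have "insert x D \<noteq> insert z (insert y D)" if "z \<in> ?M - {y}" for x z
    proof
      assume "insert x D = insert z (insert y D)"
      then have "z \<in> insert x D" "y \<in> insert x D" by simp_all
      then show False using that y by simp
    qed
    then show ?thesis by blast
  qed
  moreover have "D \<notin> (\<lambda>x. insert x D) ` ?M \<union> (\<lambda>x. insert x (insert y D)) ` (?M - {y})"
    by auto
  moreover have "card ?M > 0" using y fM card_gt_0_iff by blast
  ultimately have cL: "card L = 2 * card ?M"
    using fM by (simp add: L_def card_Un_disjoint)
  then show "card ?P \<ge> 2 * card ?M" using card_mono[OF finP LP] by simp
  assume "card ?M \<ge> 3"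
  \<comment> \<open>A pair \<open>T\<close> avoiding both \<open>D\<close> and \<open>y\<close>
    gives one more set: \<open>D \<union> T\<close> is too large to extend \<open>D\<close> by at
    most one element, and every other member of \<open>L\<close> contains \<open>y\<close>.\<close>
  then have "card (?M - {y}) \<ge> 2" using y fM by simp
  then obtain T where T: "T \<subseteq> ?M - {y}" "card T = 2"
    by (meson obtain_subset_with_card_n)
  have "card (D \<union> T) = card D + 2"
    using T fD by (subst card_Un_disjoint) (auto intro: finite_subset[OF _ fM])
  then have TP: "D \<union> T \<in> ?P" using T assms(2) by auto
  have "D \<union> T \<noteq> insert x D" for x
    using \<open>card (D \<union> T) = card D + 2\<close> fD by (auto simp: card_insert_if split: if_splits)
  moreover have "y \<notin> D \<union> T" using T y by auto
  moreover have "D \<union> T \<noteq> D" using \<open>card (D \<union> T) = card D + 2\<close> by auto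
  ultimately have "D \<union> T \<notin> L" unfolding L_def by fastforce
  with LP TP have "L \<subset> ?P" by (metis psubsetI)
  from psubset_card_mono[OF finP this] show "card ?P > 2 * card ?M" by (simp only: cL)
qed

lemma pair_wf_digraph_star_graph: "pair_wf_digraph (star_graph m)"
  by unfold_locales (auto simp: star_graph_def)

text \<open>The centre goes to \<open>0\<close> and the leaves are numbered by an arbitrary
  bijection; adjacency only depends on which endpoints are the centre.\<close>

lemma digraph_iso_star_graphI:
  assumes "pair_wf_digraph G" "finite (pverts G)" "c \<in> pverts G"
    and "parcs G = {c} \<times> (pverts G - {c}) \<union> (pverts G - {c}) \<times> {c}"
  shows "digraph_iso (with_proj G) (with_proj (star_graph (card (pverts G) - 1)))"
proof -
  let ?B = "pverts G - {c}" and ?m = "card (pverts G) - 1"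
  have "card ?B = card {1..?m}" using assms(2,3) by simp
  then obtain g where g: "bij_betw g ?B {1..?m}"
    using finite_same_card_bij[of ?B "{1..?m}"] assms(2) by auto
  define f where "f v = (if v = c then 0 else g v)" for v
  have fB: "f v \<in> {1..?m}" if "v \<in> ?B" for v
    using bij_betwE[OF g] that by (auto simp: f_def)
  have "bij_betw f ?B {1..?m}"
    using g by (rule bij_betw_cong[THEN iffD1, rotated]) (auto simp: f_def)
  then have "bij_betw f (insert c ?B) (insert (f c) {1..?m})"
    by (intro notIn_Un_bij_betw[where b = c, simplified]) (auto simp: f_def)
  moreover have "insert c ?B = pverts G" using assms(3) by auto
  moreover have "insert (f c) {1..?m} = {0..?m}" by (auto simp: f_def)
  ultimately have bij: "bij_betw f (pverts G) (pverts (star_graph ?m))"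
    by (simp add: star_graph_def)
  have "(u, v) \<in> parcs G \<longleftrightarrow> (f u, f v) \<in> parcs (star_graph ?m)"
    if "u \<in> pverts G" "v \<in> pverts G" for u v
    using fB[of u] fB[of v] that
    by (cases "u = c"; cases "v = c") (auto simp: assms(4) star_graph_def f_def)
  with bij show ?thesis
    unfolding digraph_iso_with_proj_iff[OF assms(1) pair_wf_digraph_star_graph] by blast
qed

theorem theorem3p1:
  fixes G :: "'a pair_pre_digraph" and n k :: nat
  assumes "pair_graph G"
    and "card (pverts G) = n" and "n \<ge> 2"
    and "min_degree G \<ge> 1"
    and "domination_number G \<le> k" and "k \<le> n"
    and "digraph_iso (with_proj G) (with_proj (k_dominating_graph k G))"
  shows "k = 2 \<and> n \<ge> 4 \<and> digraph_iso (with_proj G) (with_proj (star_graph (n - 1)))"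
proof -
  interpret pair_graph G by fact
  interpret D: pair_graph "k_dominating_graph k G"
    by (rule pair_graph_k_dominating_graph) fact
  note wf = pair_wf_digraph_axioms
  define V where "V = pverts G"
  define P where "P = {S. dominating_set G S \<and> card S \<le> k}"
  define \<gamma> where "\<gamma> = domination_number G"
  have finV: "finite V" and cV: "card V = n" using assms(2) by (auto simp: V_def)
  have PV: "S \<subseteq> V" if "S \<in> P" for S using that by (auto simp: P_def dominating_set_def V_def)
  have finP: "finite P" using PV finV by (intro finite_subset[of P "Pow V"]) auto
  have finS: "finite S" if "S \<in> P" for S using PV[OF that] finV finite_subset by blast
  have \<gamma>_le: "\<gamma> \<le> card S" if "dominating_set G S" for S
    using domination_number_le[OF pair_finite_verts that] by (simp add: \<gamma>_def)
  obtain D where D: "dominating_set G D" "card D = \<gamma>"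
    using minimum_dominating_set[OF pair_finite_verts] unfolding \<gamma>_def by metis
  have DV: "D \<subseteq> V" using D by (auto simp: dominating_set_def V_def)
  have "V \<noteq> {}" using cV assms(3) by auto
  then have "D \<noteq> {}" using D(1) by (auto simp: dominating_set_def V_def)
  then have \<gamma>_pos: "\<gamma> \<ge> 1" using D(2) DV finV finite_subset by (metis One_nat_def Suc_leI card_gt_0_iff)
  have "D \<in> P" using D assms(5) by (auto simp: P_def \<gamma>_def)

  have arcs_D: "(S, T) \<in> parcs (k_dominating_graph k G) \<longleftrightarrow> S \<in> P \<and> T \<in> P \<and>
      ((\<exists>x. x \<notin> S \<and> T = insert x S) \<or> (\<exists>x \<in> S. T = S - {x}))" for S T
    by (auto simp: k_dominating_graph_def Let_def P_def)
  have arc_card: "card T = Suc (card S) \<or> card S = Suc (card T)"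
    if "(S, T) \<in> parcs (k_dominating_graph k G)" for S T
  proof -
    have "finite S" using that arcs_D finS by blast
    with that show ?thesis unfolding arcs_D by (auto dest: card.remove)
  qed
  have "pverts (k_dominating_graph k G) = P"
    by (simp add: k_dominating_graph_def Let_def P_def)
  then obtain f where f: "bij_betw f V P" and
    adj: "\<And>u v. u \<in> V \<Longrightarrow> v \<in> V \<Longrightarrow>
      (u, v) \<in> parcs G \<longleftrightarrow> (f u, f v) \<in> parcs (k_dominating_graph k G)"
    using assms(7)
    unfolding digraph_iso_with_proj_iff[OF wf D.pair_wf_digraph_axioms] V_def by auto
  have cP: "card P = n" using bij_betw_same_card[OF f] cV by simp
  have fP: "f u \<in> P" if "u \<in> V" for u using f that by (auto dest: bij_betwE)

  \<comment> \<open>Independent sets from set sizes, and the bound n \<ge> 2\<gamma>\<close>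
  have indep_dom: "dominating_set G (V - I)"
    if "I \<subseteq> V" "\<And>u v. u \<in> I \<Longrightarrow> v \<in> I \<Longrightarrow>
      card (f v) \<noteq> Suc (card (f u))" for I
    unfolding V_def
  proof (rule dominating_set_Diff_independent[OF wf pair_finite_verts assms(4)])
    fix u v assume "u \<in> I" "v \<in> I"
    then show "(u, v) \<notin> parcs G" using that arc_card adj by (metis subsetD)
  qed
  have "n \<ge> 2 * \<gamma>"
  proof -
    let ?X = "{u \<in> V. even (card (f u))}" and ?Y = "{u \<in> V. odd (card (f u))}"
    have "dominating_set G (V - ?X)" "dominating_set G (V - ?Y)"
      by (rule indep_dom; force)+
    moreover have "V - ?X = ?Y" "V - ?Y = ?X" by auto
    ultimately have "\<gamma> \<le> card ?X" "\<gamma> \<le> card ?Y" using \<gamma>_le by simp_all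
    moreover have "card V = card (?X \<union> ?Y)" by (rule arg_cong[of _ _ card]) auto
    then have "n = card ?X + card ?Y"
      using cV finV by (subst (asm) card_Un_disjoint) auto
    ultimately show ?thesis by simp
  qed
  have "D \<noteq> V" using D(2) cV \<open>n \<ge> 2 * \<gamma>\<close> \<gamma>_pos by auto
  have cVD: "card (V - D) = n - \<gamma>"
    using card_Diff_subset[OF finite_subset[OF DV finV] DV] D(2) cV by simp

  \<comment> \<open>Excluding k = \<gamma> and k \<ge> \<gamma> + 2\<close>
  have "k \<noteq> \<gamma>"
  proof
    assume "k = \<gamma>"
    then have "card S = \<gamma>" if "S \<in> P" for S using that \<gamma>_le by (force simp: P_def)
    \<comment> \<open>All sets in \<open>P\<close> have the same size, so all of \<open>V\<close> is
      independent and the empty set would dominate.\<close>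
    then have "dominating_set G (V - V)" by (intro indep_dom) (simp_all add: fP)
    then show False using \<gamma>_le \<gamma>_pos by force
  qed
  moreover have "\<not> k \<ge> \<gamma> + 2"
  proof
    assume k: "k \<ge> \<gamma> + 2"
    let ?Q = "{S. D \<subseteq> S \<and> S \<subseteq> V \<and> card S \<le> card D + 2}"
    have QP: "?Q \<subseteq> P"
      using k D(2) dominating_set_superset[OF D(1)] by (auto simp: P_def V_def)
    have "2 * (n - \<gamma>) \<le> card ?Q"
      using card_supersets_at_least(1)[OF finV DV \<open>D \<noteq> V\<close>] cVD by simp
    \<comment> \<open>The chain
      \<open>n = card P \<ge> card ?Q \<ge> 2 * (n - \<gamma>) \<ge> n\<close> collapses, so every
      set in \<open>P\<close> contains \<open>D\<close>.\<close>
    with card_mono[OF finP QP] cP \<open>n \<ge> 2 * \<gamma>\<close> have n: "n = 2 * \<gamma>" and "card ?Q = n" by auto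
    then have "?Q = P" using card_subset_eq[OF finP QP] cP by simp
    have "\<not> n - \<gamma> \<ge> 3"
      using card_supersets_at_least(2)[OF finV DV \<open>D \<noteq> V\<close>] cVD n \<open>card ?Q = n\<close> by auto
    \<comment> \<open>From \<gamma> + 2 \<le> k \<le> n = 2\<gamma> follows \<gamma> \<ge> 2, and n
      - \<gamma> \<le> 2 gives \<gamma> \<le> 2.\<close>
    with n k assms(6) have "n = 4" "k = 4" using \<gamma>_pos by auto
    obtain d where d: "d \<in> D" using \<open>D \<noteq> {}\<close> by blast
    \<comment> \<open>A singleton is independent, so its complement dominates; having 3 elements, it
      lies in \<open>P\<close> although it misses \<open>d\<close>.\<close>
    then have "dominating_set G (V - {d})" using DV by (intro indep_dom) auto
    then have "V - {d} \<in> P"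
      using \<open>n = 4\<close> \<open>k = 4\<close> cV by (auto simp: P_def intro: order_trans[OF card_Diff1_le])
    then show False using \<open>?Q = P\<close> d by blast
  qed
  ultimately have k: "k = Suc \<gamma>" using assms(5) by (simp add: \<gamma>_def)

  \<comment> \<open>The case k = \<gamma> + 1: \<open>G\<close> is complete bipartite\<close>
  define A where "A = {u \<in> V. card (f u) = \<gamma>}"
  define B where "B = {u \<in> V. card (f u) = Suc \<gamma>}"
  have AB: "A \<inter> B = {}" "A \<subseteq> V" "B \<subseteq> V" by (auto simp: A_def B_def)
  have "card (f u) = \<gamma> \<or> card (f u) = Suc \<gamma>" if "u \<in> V" for u
    using fP[OF that] \<gamma>_le[of "f u"] k by (auto simp: P_def)
  then have VAB: "V - A = B" "V - B = A" "A \<union> B = V" by (auto simp: A_def B_def)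
  have finAB: "finite A" "finite B" using finV AB finite_subset by blast+
  have domA: "dominating_set G A" unfolding VAB(2)[symmetric]
    by (rule indep_dom) (auto simp: B_def)
  have domB: "dominating_set G B" unfolding VAB(1)[symmetric]
    by (rule indep_dom) (auto simp: A_def)
  have cAB: "card A + card B = n" using cV VAB(3) AB(1) finAB by (metis card_Un_disjoint)
  \<comment> \<open>Stated for every minimum dominating set \<open>S\<close>, not only for
    \<open>D\<close>, because it is later applied to each \<open>f u\<close> with
    \<open>u \<in> A\<close>.\<close>
  have sup: "(\<lambda>x. insert x S) ` (V - S) \<subseteq> f ` B \<and> card ((\<lambda>x. insert x S) ` (V - S)) = n - \<gamma>"
    if "dominating_set G S" "card S = \<gamma>" for S
  proof
    have SV: "S \<subseteq> V" using that by (simp add: dominating_set_def V_def)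
    then have finS: "finite S" using finV finite_subset by blast
    show "(\<lambda>x. insert x S) ` (V - S) \<subseteq> f ` B"
    proof clarify
      fix x assume x: "x \<in> V" "x \<notin> S"
      then have c: "card (insert x S) = Suc \<gamma>" using that(2) finS by simp
      have "insert x S \<in> P"
        using dominating_set_superset[OF that(1), of "insert x S"] c k x SV
        by (auto simp: P_def V_def)
      then obtain u where "u \<in> V" "f u = insert x S" using f by (metis bij_betw_imp_surj_on imageE)
      then show "insert x S \<in> f ` B" using c by (force simp: B_def)
    qed
    have "card (V - S) = n - \<gamma>" using card_Diff_subset[OF finS SV] that(2) cV by simp
    then show "card ((\<lambda>x. insert x S) ` (V - S)) = n - \<gamma>"
      by (subst card_image) (auto simp: inj_on_def)
  qed
  have injf: "inj_on f V" using f by (rule bij_betw_imp_inj_on)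
  have cfB: "card (f ` B) = card B" using inj_on_subset[OF injf AB(3)] by (rule card_image)
  have "n - \<gamma> \<le> card B"
    using sup[OF D] card_mono[of "f ` B"] finAB(2) cfB by (metis finite_imageI)
  with \<gamma>_le[OF domA] cAB have cA: "card A = \<gamma>" and cB: "card B = n - \<gamma>" by auto
  \<comment> \<open>Equal finite cardinalities turn the inclusion into an equality: the sets of size
    \<open>Suc \<gamma>\<close> in \<open>P\<close> are exactly the one-element extensions of any
    given minimum dominating set.\<close>
  have sup_eq: "(\<lambda>x. insert x S) ` (V - S) = f ` B" if "dominating_set G S" "card S = \<gamma>" for S
    using sup[OF that] card_subset_eq[of "f ` B"] finAB(2) cfB cB by (metis finite_imageI)

  have A_B: "(u, w) \<in> parcs G" if "u \<in> A" "w \<in> B" for u w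
  proof -
    have uw: "u \<in> V" "w \<in> V" using that AB by auto
    have "dominating_set G (f u)" "card (f u) = \<gamma>"
      using that fP[OF uw(1)] by (auto simp: A_def P_def)
    from sup_eq[OF this] that(2) obtain x where "x \<notin> f u" "f w = insert x (f u)" by blast
    then show ?thesis using adj[OF uw] arcs_D fP uw by blast
  qed
  then have B_A: "(w, u) \<in> parcs G" if "u \<in> A" "w \<in> B" for u w
    using that by (meson graph_symmetric)
  have pair_dom: "dominating_set G {u, w}" if "u \<in> A" "w \<in> B" for u w
    unfolding dominating_set_def
  proof (intro conjI ballI)
    show "{u, w} \<subseteq> pverts G" using that AB by (auto simp: V_def)
    fix v assume "v \<in> pverts G - {u, w}"
    then have "v \<in> A \<or> v \<in> B" using VAB(3) by (auto simp: V_def)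
    then show "\<exists>x \<in> {u, w}. (v, x) \<in> parcs G" using A_B B_A that by blast
  qed

  \<comment> \<open>Forcing \<gamma> = 1\<close>
  have "A \<noteq> {}" "B \<noteq> {}" using cA cB \<gamma>_pos \<open>n \<ge> 2 * \<gamma>\<close> by auto
  have "\<gamma> = 1"
  proof (rule ccontr)
    assume "\<gamma> \<noteq> 1"
    moreover obtain u w where "u \<in> A" "w \<in> B" using \<open>A \<noteq> {}\<close> \<open>B \<noteq> {}\<close> by blast
    then have "\<gamma> \<le> card {u, w}" using pair_dom \<gamma>_le by blast
    then have "\<gamma> \<le> 2" using card_2_iff[of "{u,w}"] by (cases "u = w") auto
    ultimately have "\<gamma> = 2" using \<gamma>_pos by simp
    \<comment> \<open>All \<gamma>(n - \<gamma>) pairs would be minimum dominating sets, but only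
      the \<gamma> vertices of \<open>A\<close> are mapped to such sets; this is impossible as n -
      \<gamma> \<ge> 2.\<close>
    let ?E = "(\<lambda>(u, w). {u, w}) ` (A \<times> B)"
    have "?E \<subseteq> f ` A"
    proof clarify
      fix u w assume uw: "u \<in> A" "w \<in> B"
      then have "u \<noteq> w" using AB by auto
      then have c: "card {u, w} = \<gamma>" using \<open>\<gamma> = 2\<close> by simp
      then have "{u, w} \<in> P" using pair_dom[OF uw] k by (simp add: P_def)
      then obtain v where "v \<in> V" "f v = {u, w}" using f by (metis bij_betw_imp_surj_on imageE)
      then show "{u, w} \<in> f ` A" using c by (force simp: A_def)
    qed
    moreover have "inj_on (\<lambda>(u, w). {u, w}) (A \<times> B)"
      using AB(1) by (auto simp: inj_on_def doubleton_eq_iff)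
    then have "card ?E = card A * card B" by (simp add: card_image card_cartesian_product)
    ultimately have "card A * card B \<le> card A"
      using finAB(1) by (metis card_image_le card_mono finite_imageI le_trans)
    then show False using cA cB \<open>\<gamma> = 2\<close> \<open>n \<ge> 2 * \<gamma>\<close> by simp
  qed
  with cA obtain c where c: "A = {c}" by (metis card_1_singletonE)
  have cB1: "card B = n - 1" using cB \<open>\<gamma> = 1\<close> by simp
  have "dominating_set G {c}" using domA c by simp

  \<comment> \<open>Excluding n \<le> 3\<close>
  have "n \<ge> 4"
  proof (rule ccontr)
    assume "\<not> n \<ge> 4"
    \<comment> \<open>The side \<open>B\<close> has n - 1 \<le> 2 = k vertices and is thus itself in
      \<open>P\<close>. Since \<open>c \<notin> B\<close>, it is neither \<open>{c}\<close>, the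
      only set of size 1 in \<open>P\<close>, nor an extension of \<open>{c}\<close>, as every set
      of size 2 in \<open>P\<close> would be.\<close>
    then have "card B \<le> k" using cB1 k \<open>\<gamma> = 1\<close> by simp
    then have "B \<in> P" using domB by (simp add: P_def)
    then obtain v where v: "v \<in> V" "f v = B" using f by (metis bij_betw_imp_surj_on imageE)
    have "c \<notin> B" using AB c by auto
    have "{c} \<in> P" using \<open>dominating_set G {c}\<close> k by (simp add: P_def)
    then obtain u where u: "u \<in> V" "f u = {c}" using f by (metis bij_betw_imp_surj_on imageE)
    have "u \<in> A" using u \<open>\<gamma> = 1\<close> by (simp add: A_def)
    show False
    proof (cases "v \<in> A")
      case True
      then show False using \<open>u \<in> A\<close> c u v \<open>c \<notin> B\<close> by auto
    next
      case False
      then have "B \<in> f ` B" using v VAB by blast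
      then show False
        using sup_eq[OF \<open>dominating_set G {c}\<close>] \<open>\<gamma> = 1\<close> \<open>c \<notin> B\<close> by auto
    qed
  qed

  \<comment> \<open>Identifying \<open>G\<close> as a star centred at \<open>c\<close>\<close>
  moreover have "parcs G = {c} \<times> (pverts G - {c}) \<union> (pverts G - {c}) \<times> {c}"
  proof
    have BV: "pverts G - {c} = B" using VAB c V_def by simp
    show "{c} \<times> (pverts G - {c}) \<union> (pverts G - {c}) \<times> {c} \<subseteq> parcs G"
      using A_B B_A c BV by auto
    have "\<not> (u \<in> B \<and> v \<in> B)" if "(u, v) \<in> parcs G" for u v
    proof
      assume uv: "u \<in> B \<and> v \<in> B"
      then have "(f u, f v) \<in> parcs (k_dominating_graph k G)" using that adj AB by blast
      from arc_card[OF this] uv show False by (simp add: B_def)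
    qed
    moreover have "u \<noteq> v \<and> (u = c \<or> u \<in> B) \<and> (v = c \<or> v \<in> B)" if "(u, v) \<in> parcs G" for u v
    proof (intro conjI)
      show "u \<noteq> v" using pair_no_loops[OF that] by simp
      show "u = c \<or> u \<in> B" "v = c \<or> v \<in> B"
        using wellformed'[OF that] BV by blast+
    qed
    ultimately show "parcs G \<subseteq> {c} \<times> (pverts G - {c}) \<union> (pverts G - {c}) \<times> {c}"
      unfolding BV by (intro subrelI) blast
  qed
  then have "digraph_iso (with_proj G) (with_proj (star_graph (n - 1)))"
    using digraph_iso_star_graphI[OF wf pair_finite_verts, of c] c AB(2) assms(2) V_def by auto
  ultimately show ?thesis using k \<open>\<gamma> = 1\<close> by simp
qed

end
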